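(* Let $q\in(-\infty,0)$ and let $\mu$ be a $q$-homogeneous $\sigma$-finite Borel measure on $\mathbb{R}^n$; in particular, the following applies if $\mu=w(x)\,dx$ where $w:\mathbb{R}^n\setminus\{0\}\to\mathbb{R}_+$ is a $p$-homogeneous Borel density with $p\in(-1/n,0)$ and $\frac1q=\frac1p+n$. Let $\|\cdot\|_K$ be an arbitrary semi-norm on $\mathbb{R}^n$ with open unit ball $K$ such that $\mu(\mathbb{R}^n\setminus K)<\infty$. Then for every Borel set $C\subset\mathbb{R}^n$ with $\mu(C)<\infty$, $$\mu^-_{\|\cdot\|_K}(C)\ \ge\ -\frac1q\,\mu(\mathbb{R}^n\setminus K)^q\,\mu(C)^{1-q},$$ with equality for $C=\mathbb{R}^n\setminus tK$, $t>0$. In other words, complements of homothetic copies of $K$ are isoperimetric minimizers for $(\mathbb{R}^n,\|\cdot\|_K,\mu)$.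
   Context: Semi-norms need not be symmetric: a semi-norm is a subadditive function $\|\cdot\|:\mathbb{R}^n\to[0,\infty)$ with $\|\lambda x\|=\lambda\|x\|$ for all $\lambda\ge0$; $K=\{x:\|x\|_K<1\}$. $\mu$ is $q$-homogeneous if $\mu(\lambda A)^q=\lambda\mu(A)^q$ (i.e. $\mu(\lambda A)=\lambda^{1/q}\mu(A)$) for every Borel $A$ and $\lambda>0$. $w$ is $p$-homogeneous if $w(\lambda x)^p=\lambda w(x)^p$ (i.e. $w(\lambda x)=\lambda^{1/p}w(x)$) for all $x\ne0$, $\lambda>0$. Inner Minkowski boundary measure: $\mu^-_{\|\cdot\|_K}(C)=\liminf_{\epsilon\to0^+}\frac{\mu((A+\epsilon K)\setminus A)}{\epsilon}$ with $A=\mathbb{R}^n\setminus C$, where $A+\epsilon K$ is the Minkowski sum. Conventions: $0^q=\infty$ for $q<0$, and $\infty\cdot0=0$. *)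

theory Defs
  imports "HOL-Analysis.Analysis"
begin

text \<open>
  Real powers on \<open>[0,\<infinity>]\<close>, with \<open>0\<^sup>r = \<infinity>\<close> and \<open>\<infinity>\<^sup>r = 0\<close> for \<open>r < 0\<close>. The other convention
  needed, \<open>\<infinity> \<cdot> 0 = 0\<close>, is the one built into multiplication on \<^typ>\<open>ennreal\<close>.
\<close>

definition enn_powr :: "ennreal \<Rightarrow> real \<Rightarrow> ennreal" where
  "enn_powr x r =
    (if r = 0 then 1
     else if x = 0 then (if r < 0 then \<infinity> else 0)
     else if x = \<infinity> then (if r < 0 then 0 else \<infinity>)
     else ennreal (enn2real x powr r))"

definition homogeneous_measure :: "real \<Rightarrow> ('a::euclidean_space) measure \<Rightarrow> bool" where
  "homogeneous_measure q \<mu> \<longleftrightarrow>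
    (\<forall>A \<in> sets borel. \<forall>l>0.
      enn_powr (emeasure \<mu> ((*\<^sub>R) l ` A)) q = ennreal l * enn_powr (emeasure \<mu> A) q)"

text \<open>
  A density lives on the complement of the origin; its value at \<open>0\<close> is arbitrary.
\<close>

definition homogeneous_density :: "real \<Rightarrow> (('a::euclidean_space) \<Rightarrow> real) \<Rightarrow> bool" where
  "homogeneous_density p w \<longleftrightarrow>
    (\<forall>x. x \<noteq> 0 \<longrightarrow> (\<forall>l>0.
      enn_powr (ennreal (w (l *\<^sub>R x))) p = ennreal l * enn_powr (ennreal (w x)) p))"

text \<open>
  Semi-norms are only positively homogeneous: \<open>N (- x) = N x\<close> is not required.
\<close>

definition semi_norm :: "(('a::real_vector) \<Rightarrow> real) \<Rightarrow> bool" where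
  "semi_norm N \<longleftrightarrow>
    (\<forall>x. 0 \<le> N x) \<and>
    (\<forall>x y. N (x + y) \<le> N x + N y) \<and>
    (\<forall>l\<ge>0. \<forall>x. N (l *\<^sub>R x) = l * N x)"

definition unit_ball :: "('a \<Rightarrow> real) \<Rightarrow> 'a set" where
  "unit_ball N = {x. N x < 1}"

text \<open>
  The \<open>+\<close> below is the Minkowski sum of sets, while \<open>-\<close> is set difference.
\<close>

definition inner_boundary_measure ::
    "('a::euclidean_space) measure \<Rightarrow> ('a \<Rightarrow> real) \<Rightarrow> 'a set \<Rightarrow> ennreal" where
  "inner_boundary_measure \<mu> N C =
    (let A = UNIV - C in
      Liminf (at_right 0)
        (\<lambda>e. emeasure \<mu> ((A + (*\<^sub>R) e ` unit_ball N) - A) / ennreal e))"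

definition isoperimetric_minimizer ::
    "('a::euclidean_space) measure \<Rightarrow> ('a \<Rightarrow> real) \<Rightarrow> 'a set \<Rightarrow> bool" where
  "isoperimetric_minimizer \<mu> N C \<longleftrightarrow>
    C \<in> sets borel \<and> emeasure \<mu> C < \<infinity> \<and>
    (\<forall>D \<in> sets borel. emeasure \<mu> D = emeasure \<mu> C \<longrightarrow>
      inner_boundary_measure \<mu> N C \<le> inner_boundary_measure \<mu> N D)"

end

theory Submission
  imports Defs
begin

text \<open>
  Put \<open>u = 1/q < 0\<close>, so that \<open>\<mu>\<close> scales by \<open>\<mu>(l A) = l\<^sup>u \<mu>(A)\<close> and is, in polar coordinates, an integral
  over rays of the measure \<open>r\<^sup>u\<^sup>-\<^sup>1 dr\<close>. On a ray, let \<open>D\<close> be the complement of \<open>A + [0, h)\<close>, where \<open>A\<close>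
  is the complement of \<open>C\<close>; then \<open>D - h\<close> lies in \<open>C\<close> up to its boundary, and comparing densities gives
  \<open>\<nu>(D) \<le> (1-s)\<^sup>1\<^sup>-\<^sup>u \<nu>(C) + s\<^sup>1\<^sup>-\<^sup>u \<nu>[h, \<infinity>)\<close> for every \<open>0 < s < 1\<close>. This is the family of tangents to
  the complemented Brunn-Minkowski inequality \<open>\<nu>(D)\<^sup>q \<ge> \<nu>(C)\<^sup>q + \<nu>[h, \<infinity>)\<^sup>q\<close>; being linear in the
  measures, it integrates over the rays. Taking \<open>s = c \<epsilon>\<close> and \<open>\<epsilon> \<rightarrow> 0\<close> bounds the
  boundary measure of \<open>C\<close> below by \<open>(1-u) c a - c\<^sup>1\<^sup>-\<^sup>u b\<close> with \<open>a = \<mu>(C)\<close> and \<open>b\<close> the measure of the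
  complement of \<open>K\<close>, and \<open>c = (b/a)\<^sup>q\<close> is the optimal choice.
\<close>

section \<open>Negative powers on the extended half-line\<close>

lemma enn_powr_neg_eq_0_iff: "q < 0 \<Longrightarrow> enn_powr x q = 0 \<longleftrightarrow> x = \<infinity>"
  by (auto simp: enn_powr_def enn2real_eq_0_iff)

lemma enn_powr_neg_eq_infinity_iff: "q < 0 \<Longrightarrow> enn_powr x q = \<infinity> \<longleftrightarrow> x = 0"
  by (auto simp: enn_powr_def)

lemma enn_powr_ennreal: "0 < x \<Longrightarrow> enn_powr (ennreal x) r = ennreal (x powr r)"
  by (auto simp: enn_powr_def)

text \<open>For \<open>q < 0\<close> the power map is an order-reversing bijection of the extended
  half-line exchanging 0 and infinity, so it can be inverted at those two values as well. This turns
  homogeneity, stated through \<open>q\<close>-th powers, into a linear scaling law.\<close>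

lemma enn_powr_neg_scale_iff:
  assumes "q < 0" "0 < l"
  shows "enn_powr y q = ennreal l * enn_powr x q \<longleftrightarrow> y = ennreal (l powr (1 / q)) * x"
proof -
  consider "x = 0" | "x = \<infinity>" | a where "0 < a" "x = ennreal a"
    by (cases x) (auto simp: order_less_le)
  then show ?thesis
  proof cases
    case 1
    then have "ennreal l * enn_powr x q = \<infinity>"
      using assms by (simp add: enn_powr_def ennreal_mult_eq_top_iff)
    then show ?thesis using enn_powr_neg_eq_infinity_iff[OF assms(1), of y] 1 by simp
  next
    case 2
    then have "ennreal l * enn_powr x q = 0"
      using assms by (simp add: enn_powr_def)
    moreover have "ennreal (l powr (1 / q)) * x = \<infinity>"
      using 2 assms by (simp add: ennreal_mult_eq_top_iff)
    ultimately show ?thesis using enn_powr_neg_eq_0_iff[OF assms(1), of y] by metis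
  next
    case 3
    then have x: "ennreal l * enn_powr x q = ennreal (l * a powr q)"
      using assms by (simp add: enn_powr_ennreal ennreal_mult)
    consider "y = 0" | "y = \<infinity>" | b where "0 < b" "y = ennreal b"
      by (cases y) (auto simp: order_less_le)
    then show ?thesis
    proof cases
      case 1
      have "ennreal l * ennreal (a powr q) \<noteq> top"
        by (simp add: ennreal_mult_eq_top_iff)
      then show ?thesis using 1 3 assms by (simp add: x) (simp add: enn_powr_def ennreal_mult)
    next
      case 2
      then show ?thesis using 3 assms
        by (simp add: x) (auto simp: enn_powr_def ennreal_mult[symmetric])
    next
      case (3 b)
      have "b powr q = l * a powr q \<longleftrightarrow> b = l powr (1 / q) * a"
      proof
        assume "b powr q = l * a powr q"
        then have "(b powr q) powr (1 / q) = (l * a powr q) powr (1 / q)" by simp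
        then show "b = l powr (1 / q) * a"
          using assms 3 \<open>0 < a\<close> by (simp add: powr_powr powr_mult)
      next
        assume "b = l powr (1 / q) * a"
        then show "b powr q = l * a powr q"
          using assms 3 \<open>0 < a\<close> by (simp add: powr_powr powr_mult)
      qed
      with 3 \<open>0 < a\<close> \<open>x = ennreal a\<close> assms show ?thesis
        unfolding x by (simp add: enn_powr_ennreal ennreal_mult[symmetric])
    qed
  qed
qed

lemma divide_ennreal_pos: "0 < e \<Longrightarrow> ennreal x / ennreal e = ennreal (x / e)"
  by (cases "0 \<le> x") (simp_all add: divide_ennreal ennreal_neg divide_nonpos_pos)

section \<open>Measures with a scaling law\<close>

locale scaling_measure = sigma_finite_measure M
  for M :: "('a :: euclidean_space) measure" +
  fixes u :: real
  assumes sets_eq_borel [measurable_cong]: "sets M = sets borel"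
    and exponent_neg: "u < 0"
    and emeasure_scaleR: "\<And>A l. A \<in> sets borel \<Longrightarrow> 0 < l \<Longrightarrow>
      emeasure M ((*\<^sub>R) l ` A) = ennreal (l powr u) * emeasure M A"
begin

lemma space_eq_UNIV: "space M = UNIV"
  using sets_eq_imp_space_eq[OF sets_eq_borel] by simp

text \<open>The origin is fixed by every dilation, so its mass \<open>m\<close> satisfies
  \<open>m = 2 powr u * m\<close> with a factor below 1; sigma-finiteness rules out
  \<open>m = \<infinity>\<close>.\<close>

lemma emeasure_singleton_0: "emeasure M {0} = 0"
proof -
  obtain A where A: "range A \<subseteq> sets M" "(\<Union>i::nat. A i) = space M" "\<And>i. emeasure M (A i) \<noteq> \<infinity>"
    using sigma_finite by metis
  then obtain i where "0 \<in> A i" unfolding space_eq_UNIV by blast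
  then have "emeasure M {0} \<le> emeasure M (A i)"
    using A by (intro emeasure_mono) auto
  with A(3)[of i] have fin: "emeasure M {0} \<noteq> \<infinity>"
    by (auto simp: top_unique)
  then obtain r where r: "0 \<le> r" "emeasure M {0} = ennreal r"
    by (cases "emeasure M {0}") auto
  have "emeasure M {0} = ennreal (2 powr u) * emeasure M {0}"
    using emeasure_scaleR[of "{0}" 2] by simp
  then have "r = 2 powr u * r"
    using r by (simp add: ennreal_mult[symmetric])
  moreover have "2 powr u < (1 :: real)"
    using exponent_neg powr_less_mono[of u 0 2] by simp
  ultimately have "r = 0" by auto
  with r show ?thesis by simp
qed

text \<open>The preimage under dilation by \<open>l\<close> is the image under dilation by
  \<open>1 / l\<close>, which flips the sign of the exponent.\<close>

lemma distr_scaleR: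
  assumes "0 < l"
  shows "distr M borel ((*\<^sub>R) l) = scale_measure (ennreal (l powr (-u))) M"
proof (rule measure_eqI)
  show "sets (distr M borel ((*\<^sub>R) l)) = sets (scale_measure (ennreal (l powr (-u))) M)"
    by (simp add: sets_eq_borel)
  fix A assume "A \<in> sets (distr M borel ((*\<^sub>R) l))"
  then have A: "A \<in> sets borel" by simp
  have "(*\<^sub>R) l -` A = (*\<^sub>R) (1 / l) ` A"
  proof (intro equalityI subsetI)
    fix x assume "x \<in> (*\<^sub>R) l -` A"
    then show "x \<in> (*\<^sub>R) (1 / l) ` A"
      using assms by (intro image_eqI[where x = "l *\<^sub>R x"]) auto
  qed (use assms in auto)
  moreover have "(1 / l) powr u = l powr (-u)"
    using assms by (simp add: powr_divide powr_minus_divide)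
  ultimately show "emeasure (distr M borel ((*\<^sub>R) l)) A
      = emeasure (scale_measure (ennreal (l powr (-u))) M) A"
    using A assms emeasure_scaleR[of A "1 / l"]
    by (simp add: emeasure_distr space_eq_UNIV)
qed

lemma nn_integral_scaleR:
  assumes [measurable]: "f \<in> borel_measurable borel" and l: "0 < l"
  shows "(\<integral>\<^sup>+x. f (l *\<^sub>R x) \<partial>M) = ennreal (l powr (-u)) * (\<integral>\<^sup>+x. f x \<partial>M)"
proof -
  have "(\<integral>\<^sup>+x. f (l *\<^sub>R x) \<partial>M) = (\<integral>\<^sup>+x. f x \<partial>distr M borel ((*\<^sub>R) l))"
    by (subst nn_integral_distr) auto
  also have "\<dots> = ennreal (l powr (-u)) * (\<integral>\<^sup>+x. f x \<partial>M)"
    unfolding distr_scaleR[OF l] by (rule nn_integral_scale_measure) measurable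
  finally show ?thesis .
qed

section \<open>Polar coordinates\<close>

definition radial_measure :: "real measure" where
  "radial_measure = density lborel (\<lambda>r. ennreal (r powr (u - 1)) * indicator {0<..} r)"

lemma sets_radial_measure [simp, measurable_cong]: "sets radial_measure = sets borel"
  by (simp add: radial_measure_def)

text \<open>
  Polar coordinates without a disintegration of the measure: insert
  \<open>1 = \<integral>\<^sub>0\<^sup>\<infinity> 1{r \<le> norm x} / norm x dr\<close> and rescale by \<open>r\<close> under the integral sign.
\<close>

lemma nn_integral_polar:
  fixes f :: "'a \<Rightarrow> ennreal"
  assumes f [measurable]: "f \<in> borel_measurable borel"
  shows "(\<integral>\<^sup>+x. f x \<partial>M) =
    (\<integral>\<^sup>+x. ennreal (1 / norm x) * indicator {x. 1 \<le> norm x} x *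
      (\<integral>\<^sup>+r. f (r *\<^sub>R x) \<partial>radial_measure) \<partial>M)"
proof -
  interpret pair_sigma_finite M "lborel :: real measure" by standard
  let ?g = "\<lambda>x::'a. ennreal (1 / norm x) * indicator {x. 1 \<le> norm x} x"
  have [measurable]: "Measurable.pred (M \<Otimes>\<^sub>M lborel) (\<lambda>p::'a \<times> real. 0 < snd p \<and> snd p \<le> norm (fst p))"
    by measurable
  \<comment> \<open>The weight inserted below integrates to 1 only off the origin, so the origin has
    to be a null set.\<close>
  have AE0: "AE x in M. x \<noteq> 0"
    using emeasure_singleton_0 by (intro AE_I[of _ _ "{0}"]) (auto simp: sets_eq_borel)
  have one: "(\<integral>\<^sup>+r. ennreal (1 / norm x) * indicator {0<..norm x} r \<partial>lborel) = 1"
    if "x \<noteq> 0" for x :: 'a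
    using that by (subst nn_integral_cmult) (auto simp: ennreal_mult[symmetric])
  have "(\<integral>\<^sup>+x. f x \<partial>M)
      = (\<integral>\<^sup>+x. f x * (\<integral>\<^sup>+r. ennreal (1 / norm x) * indicator {0<..norm x} r \<partial>lborel) \<partial>M)"
    using AE0 by (intro nn_integral_cong_AE, eventually_elim) (subst one, auto)
  also have "\<dots> = (\<integral>\<^sup>+x. (\<integral>\<^sup>+r. f x * (ennreal (1 / norm x) *
      indicator {p. 0 < snd p \<and> snd p \<le> norm (fst p)} (x, r)) \<partial>lborel) \<partial>M)"
    by (intro nn_integral_cong, subst nn_integral_cmult[symmetric])
       (auto intro!: nn_integral_cong simp: indicator_def)
  also have "\<dots> = (\<integral>\<^sup>+r. (\<integral>\<^sup>+x. f x * (ennreal (1 / norm x) *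
      indicator {p. 0 < snd p \<and> snd p \<le> norm (fst p)} (x, r)) \<partial>M) \<partial>lborel)"
    by (rule Fubini'[symmetric]) measurable
  also have "\<dots> = (\<integral>\<^sup>+r. (\<integral>\<^sup>+x. ?g x *
      (f (r *\<^sub>R x) * (ennreal (r powr (u - 1)) * indicator {0<..} r)) \<partial>M) \<partial>lborel)"
  proof (rule nn_integral_cong)
    fix r :: real
    show "(\<integral>\<^sup>+x. f x * (ennreal (1 / norm x) *
        indicator {p. 0 < snd p \<and> snd p \<le> norm (fst p)} (x, r)) \<partial>M) =
      (\<integral>\<^sup>+x. ?g x * (f (r *\<^sub>R x) * (ennreal (r powr (u - 1)) * indicator {0<..} r)) \<partial>M)"
    proof (cases "0 < r")
      case True
      \<comment> \<open>\<open>H ((1 / r) *\<^sub>R x)\<close> is the integrand at \<open>x\<close>.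
        Undoing this dilation yields the factor \<open>(1 / r) powr (- u)\<close>, that is
        \<open>r powr u\<close>, and the \<open>1 / r\<close> inside \<open>H\<close> completes it
        to the radial density \<open>r powr (u - 1)\<close>.\<close>
      define H where "H y = f (r *\<^sub>R y) * (ennreal (1 / (r * norm y)) * indicator {y. 1 \<le> norm y} y)"
        for y
      have [measurable]: "H \<in> borel_measurable borel" unfolding H_def by measurable
      have "(\<integral>\<^sup>+x. f x * (ennreal (1 / norm x) *
          indicator {p. 0 < snd p \<and> snd p \<le> norm (fst p)} (x, r)) \<partial>M) = (\<integral>\<^sup>+x. H ((1 / r) *\<^sub>R x) \<partial>M)"
        using True by (intro nn_integral_cong) (auto simp: H_def indicator_def field_simps)
      also have "\<dots> = ennreal ((1 / r) powr (-u)) * (\<integral>\<^sup>+x. H x \<partial>M)"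
        using True by (intro nn_integral_scaleR) auto
      also have "\<dots> = (\<integral>\<^sup>+x. ennreal ((1 / r) powr (-u)) * H x \<partial>M)"
        by (rule nn_integral_cmult[symmetric]) measurable
      also have "\<dots> = (\<integral>\<^sup>+x. ?g x *
          (f (r *\<^sub>R x) * (ennreal (r powr (u - 1)) * indicator {0<..} r)) \<partial>M)"
      proof (rule nn_integral_cong)
        fix x :: 'a
        have "(1 / r) powr (-u) * (1 / (r * norm x)) = 1 / norm x * r powr (u - 1)"
          using True by (simp add: powr_divide powr_minus powr_diff field_simps)
        then have *: "ennreal ((1 / r) powr (-u)) * ennreal (1 / (r * norm x)) =
            ennreal (1 / norm x) * ennreal (r powr (u - 1))"
          using True by (subst (1 2) ennreal_mult[symmetric]) auto
        have "ennreal ((1 / r) powr (-u)) * H x = (ennreal ((1 / r) powr (-u)) *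
            ennreal (1 / (r * norm x))) * (f (r *\<^sub>R x) * indicator {y. 1 \<le> norm y} x)"
          by (simp add: H_def mult_ac)
        then show "ennreal ((1 / r) powr (-u)) * H x = ?g x *
          (f (r *\<^sub>R x) * (ennreal (r powr (u - 1)) * indicator {0<..} r))"
          using True unfolding * by (simp add: mult_ac)
      qed
      finally show ?thesis .
    qed auto
  qed
  also have "\<dots> = (\<integral>\<^sup>+x. (\<integral>\<^sup>+r. ?g x *
      (f (r *\<^sub>R x) * (ennreal (r powr (u - 1)) * indicator {0<..} r)) \<partial>lborel) \<partial>M)"
    by (rule Fubini') measurable
  also have "\<dots> = (\<integral>\<^sup>+x. ?g x * (\<integral>\<^sup>+r. f (r *\<^sub>R x) \<partial>radial_measure) \<partial>M)"
  proof (rule nn_integral_cong)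
    fix x :: 'a
    show "(\<integral>\<^sup>+r. ?g x * (f (r *\<^sub>R x) * (ennreal (r powr (u - 1)) * indicator {0<..} r)) \<partial>lborel)
        = ?g x * (\<integral>\<^sup>+r. f (r *\<^sub>R x) \<partial>radial_measure)"
      unfolding radial_measure_def
      by (subst nn_integral_density) (auto simp: mult_ac nn_integral_cmult[symmetric])
  qed
  finally show ?thesis .
qed

section \<open>The one-dimensional inequality on a ray\<close>

lemma emeasure_radial_measure:
  assumes [measurable]: "A \<in> sets borel"
  shows "emeasure radial_measure A =
    (\<integral>\<^sup>+r. ennreal (r powr (u - 1)) * indicator {0<..} r * indicator A r \<partial>lborel)"
  unfolding radial_measure_def by (subst emeasure_density) auto

text \<open>The density is not integrable at 0: on \<open>{0<..d}\<close> it is at least its value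
  at \<open>d\<close>, which gives mass at least \<open>d powr u\<close>, unbounded as
  \<open>d\<close> tends to 0. Rays on which \<open>C\<close> contains an initial segment are
  thereby harmless, since the upper bound is infinite there.\<close>

lemma emeasure_radial_measure_top:
  assumes [measurable]: "A \<in> sets borel" and t: "0 < t" and A: "{0<..t} \<subseteq> A"
  shows "emeasure radial_measure A = \<infinity>"
proof (rule ccontr)
  have lower: "ennreal (d powr u) \<le> emeasure radial_measure A" if d: "0 < d" "d \<le> t" for d
  proof -
    have "ennreal (d powr u) = ennreal (d powr (u - 1)) * ennreal d"
      using d by (simp add: ennreal_mult[symmetric] powr_diff)
    also have "\<dots> = (\<integral>\<^sup>+r. ennreal (d powr (u - 1)) * indicator {0<..d} r \<partial>lborel)"
      using d by (subst nn_integral_cmult) auto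
    also have "\<dots> \<le> emeasure radial_measure A"
      unfolding emeasure_radial_measure[OF assms(1)]
      using A d exponent_neg
      by (intro nn_integral_mono) (auto simp: indicator_def intro!: ennreal_leI powr_mono2')
    finally show ?thesis .
  qed
  assume "emeasure radial_measure A \<noteq> \<infinity>"
  then obtain r where r: "0 \<le> r" "emeasure radial_measure A = ennreal r"
    by (cases "emeasure radial_measure A") auto
  \<comment> \<open>\<open>d powr u\<close> is at least \<open>r + 1\<close> because
    \<open>u < 0\<close> and \<open>d\<close> is at most \<open>(r + 1) powr (1 / u)\<close>; the
    minimum keeps \<open>d\<close> inside the given segment.\<close>
  define d where "d = min t ((r + 1) powr (1 / u))"
  have "0 < d" "d \<le> t" using t r by (auto simp: d_def)
  have "r + 1 = ((r + 1) powr (1 / u)) powr u"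
    using r exponent_neg by (simp add: powr_powr)
  also have "\<dots> \<le> d powr u"
    using \<open>0 < d\<close> exponent_neg by (intro powr_mono2') (auto simp: d_def)
  finally have "ennreal (r + 1) \<le> ennreal r"
    using lower[OF \<open>0 < d\<close> \<open>d \<le> t\<close>] r by (metis ennreal_leI order_trans)
  then show False using r by (simp add: ennreal_le_iff)
qed

lemma powr_tendsto_0: "((\<lambda>x::real. (x - c) powr u) \<longlongrightarrow> 0) at_top"
proof (rule tendsto_neg_powr[OF exponent_neg])
  show "filterlim (\<lambda>x. x - c) at_top at_top"
    using filterlim_tendsto_add_at_top[OF tendsto_const[of "- c"] filterlim_ident]
    by (simp add: algebra_simps)
qed

lemma emeasure_radial_measure_atLeast:
  assumes h: "0 < h"
  shows "emeasure radial_measure {h..} = ennreal (- (h powr u / u))"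
proof -
  have "emeasure radial_measure {h..} =
      (\<integral>\<^sup>+r. ennreal (r powr (u - 1)) * indicator {h..} r \<partial>lborel)"
    using h by (subst emeasure_radial_measure) (auto intro!: nn_integral_cong simp: indicator_def)
  also have "\<dots> = ennreal (0 - h powr u / u)"
  proof (rule nn_integral_FTC_atLeast)
    show "((\<lambda>x. x powr u / u) has_real_derivative x powr (u - 1)) (at x)" if "h \<le> x" for x
      using that h exponent_neg by (auto intro!: derivative_eq_intros)
    show "((\<lambda>x. x powr u / u) \<longlongrightarrow> 0) at_top"
      using tendsto_divide[OF powr_tendsto_0[of 0] tendsto_const[of u]] exponent_neg by simp
  qed auto
  finally show ?thesis by simp
qed

text \<open>
  On \<open>(h, h/s]\<close> the density at \<open>r\<close> is dominated by the one at \<open>(r - h) / (1 - s)\<close>; beyond \<open>h/s\<close>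
  the difference of the two has total mass \<open>s * \<nu> [h/s, \<infinity>)\<close>.
\<close>

lemma emeasure_radial_measure_shift:
  assumes [measurable]: "C \<in> sets borel" "D \<in> sets borel"
    and h: "0 < h" and s: "0 < s" "s < 1"
    and D: "\<And>r. r \<in> D \<Longrightarrow> h < r \<and> r - h \<in> C"
  shows "emeasure radial_measure D \<le>
    ennreal ((1 - s) powr (1 - u)) * emeasure radial_measure C +
    ennreal (s powr (1 - u)) * emeasure radial_measure {h..}"
proof -
  let ?k = "(1 - s) powr (1 - u)"
  let ?C = "\<lambda>r. ennreal (r powr (u - 1)) * indicator {0<..} r * indicator C r"
  let ?e = "\<lambda>r. r powr (u - 1) - ?k * (r - h) powr (u - 1)"
  \<comment> \<open>\<open>h / s\<close> is the fixed point of the map sending \<open>r\<close> to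
    \<open>(r - h) / (1 - s)\<close>, which lies below the identity to its left and above it to its
    right; the two densities cross there.\<close>
  have hs: "h < h / s" using h s by (simp add: field_simps)
  have k: "?k * y powr (u - 1) = (y / (1 - s)) powr (u - 1)" if "0 \<le> y" for y
    using that s powr_minus_divide[of "1 - s" "u - 1"] by (simp add: powr_divide)
  have excess: "(\<integral>\<^sup>+r. ennreal (?e r) * indicator {h/s..} r \<partial>lborel) =
      ennreal (s powr (1 - u)) * emeasure radial_measure {h..}"
  proof -
    let ?F = "\<lambda>r. r powr u / u - ?k * ((r - h) powr u / u)"
    have "(\<integral>\<^sup>+r. ennreal (?e r) * indicator {h/s..} r \<partial>lborel) = ennreal (0 - ?F (h / s))"
    proof (rule nn_integral_FTC_atLeast)
      fix x assume x: "h / s \<le> x"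
      with hs h have pos: "0 < x" "0 < x - h" by auto
      show "(?F has_real_derivative ?e x) (at x)"
        using pos exponent_neg by (auto intro!: derivative_eq_intros)
      have "x \<le> (x - h) / (1 - s)" using x s by (simp add: field_simps)
      then have "((x - h) / (1 - s)) powr (u - 1) \<le> x powr (u - 1)"
        using pos exponent_neg by (intro powr_mono2') auto
      then show "0 \<le> ?e x" using k[of "x - h"] pos by simp
    next
      have "(?F \<longlongrightarrow> 0 / u - ?k * (0 / u)) at_top"
        using powr_tendsto_0[of 0] powr_tendsto_0[of h] exponent_neg
        by (intro tendsto_intros) auto
      then show "(?F \<longlongrightarrow> 0) at_top" by simp
    qed measurable
    also have "0 - ?F (h / s) = s powr (1 - u) * (- (h powr u / u))"
    proof -
      \<comment> \<open>At \<open>h / s\<close> the shifted argument is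
        \<open>(1 - s) * (h / s)\<close>, so the two terms of \<open>?F\<close> combine to
        \<open>s * ((h / s) powr u / u)\<close>.\<close>
      have split: "h / s - h = (1 - s) * (h / s)" using s by (simp add: field_simps)
      have "?k * (1 - s) powr u = 1 - s"
        using s by (simp add: powr_add[symmetric])
      then have "?k * (h / s - h) powr u = (1 - s) * (h / s) powr u"
        using s h unfolding split powr_mult by (metis mult.assoc)
      moreover have "s * (h / s) powr u = s powr (1 - u) * h powr u"
        using s h by (simp add: powr_divide powr_diff field_simps)
      ultimately show ?thesis using exponent_neg by (simp add: field_simps)
    qed
    finally show ?thesis
      using h exponent_neg
      by (simp add: emeasure_radial_measure_atLeast flip: ennreal_mult')
  qed
  \<comment> \<open>The shift is written \<open>- h + 1 * r\<close> to match the affine substitution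
    rule applied to this integral at the end.\<close>
  have "emeasure radial_measure D \<le>
      (\<integral>\<^sup>+r. ennreal ?k * ?C (- h + 1 * r) + ennreal (?e r) * indicator {h/s..} r \<partial>lborel)"
    unfolding emeasure_radial_measure[OF assms(2)]
  proof (rule nn_integral_mono)
    fix r
    show "ennreal (r powr (u - 1)) * indicator {0<..} r * indicator D r \<le>
        ennreal ?k * ?C (- h + 1 * r) + ennreal (?e r) * indicator {h/s..} r"
    proof (cases "r \<in> D")
      case True
      with D[of r] h have r: "h < r" "r - h \<in> C" "0 < r" by auto
      have C: "ennreal ?k * ?C (- h + 1 * r) = ennreal (?k * (r - h) powr (u - 1))"
        using r by (simp add: ennreal_mult)
      show ?thesis
      proof (cases "h / s \<le> r")
        case True
        then show ?thesis unfolding C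
          using r \<open>r \<in> D\<close> by (simp add: ennreal_plus_if)
      next
        case False
        then have "(r - h) / (1 - s) \<le> r" using s by (simp add: field_simps)
        then have "r powr (u - 1) \<le> ((r - h) / (1 - s)) powr (u - 1)"
          using r s exponent_neg by (intro powr_mono2') auto
        then show ?thesis unfolding C
          using r \<open>r \<in> D\<close> k[of "r - h"] False by (simp add: ennreal_leI)
      qed
    qed simp
  qed
  also have "\<dots> = ennreal ?k * (\<integral>\<^sup>+r. ?C (- h + 1 * r) \<partial>lborel) +
      (\<integral>\<^sup>+r. ennreal (?e r) * indicator {h/s..} r \<partial>lborel)"
    by (subst nn_integral_add) (auto simp: nn_integral_cmult)
  also have "(\<integral>\<^sup>+r. ?C (- h + 1 * r) \<partial>lborel) = emeasure radial_measure C"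
    unfolding emeasure_radial_measure[OF assms(1)]
    by (subst nn_integral_real_affine[where c = 1 and t = "- h"]) auto
  finally show ?thesis unfolding excess .
qed

lemma emeasure_radial_measure_pos:
  assumes [measurable]: "A \<in> sets borel"
  shows "emeasure radial_measure A = emeasure radial_measure (A \<inter> {0<..})"
proof -
  have "A \<inter> {0<..} \<in> sets borel" by measurable
  then show ?thesis
    unfolding emeasure_radial_measure[OF assms]
    by (subst emeasure_radial_measure) (auto intro!: nn_integral_cong simp: indicator_def)
qed

section \<open>Integration over rays\<close>

lemma emeasure_polar:
  assumes [measurable]: "A \<in> sets borel"
  shows "emeasure M A = (\<integral>\<^sup>+x. ennreal (1 / norm x) * indicator {x. 1 \<le> norm x} x *
      emeasure radial_measure {r. r *\<^sub>R x \<in> A} \<partial>M)"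
proof -
  have "(\<integral>\<^sup>+r. indicator A (r *\<^sub>R x) \<partial>radial_measure) = emeasure radial_measure {r. r *\<^sub>R x \<in> A}"
    for x :: 'a
  proof -
    have "(\<integral>\<^sup>+r. indicator A (r *\<^sub>R x) \<partial>radial_measure) =
        (\<integral>\<^sup>+r. indicator {r. r *\<^sub>R x \<in> A} r \<partial>radial_measure)"
      by (intro nn_integral_cong) (simp add: indicator_def)
    then show ?thesis by (subst (asm) nn_integral_indicator) auto
  qed
  then show ?thesis
    using nn_integral_polar[of "indicator A"] by (simp add: sets_eq_borel)
qed

text \<open>This provides the measurability of the section masses as functions of the base point, so
  that the ray inequality can be integrated.\<close>

lemma sigma_finite_radial_measure: "sigma_finite_measure radial_measure"
proof -
  have "AE r in lborel. ennreal (r powr (u - 1)) * indicator {0<..} r \<noteq> \<infinity>"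
    by (intro AE_I2) (simp split: split_indicator)
  then show ?thesis
    unfolding radial_measure_def
    by (subst sigma_finite_measure.sigma_finite_iff_density_finite[OF sigma_finite_lborel]) measurable
qed

text \<open>On the ray through \<open>x\<close>, moving toward the origin by \<open>N\<close>-length
  \<open>e\<close> shifts the parameter by \<open>h = e / N x\<close>, and \<open>{h..}\<close> is
  contained in the section of \<open>{x. e \<le> N x}\<close>. The ray inequality for this
  \<open>h\<close> has coefficients independent of \<open>x\<close>, so it integrates in polar
  coordinates. The last hypothesis says that points of \<open>D\<close>, moved radially inward by at
  most \<open>e\<close>, lie in \<open>C\<close>.\<close>

lemma emeasure_le_of_radial_erosion:
  fixes N :: "'a \<Rightarrow> real"
  assumes [measurable]: "C \<in> sets borel" "D \<in> sets borel" "N \<in> borel_measurable borel"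
    and N: "\<And>x. 0 \<le> N x" "\<And>r x. 0 < r \<Longrightarrow> N (r *\<^sub>R x) = r * N x"
    and e: "0 < e" and s: "0 < s" "s < 1"
    and D: "\<And>x r. x \<in> D \<Longrightarrow> 0 < r \<Longrightarrow> r \<le> 1 \<Longrightarrow> (1 - r) * N x \<le> e \<Longrightarrow> r *\<^sub>R x \<in> C"
  shows "emeasure M D \<le>
    ennreal ((1 - s) powr (1 - u)) * emeasure M C +
    ennreal (s powr (1 - u)) * emeasure M {x. e \<le> N x}"
proof -
  let ?g = "\<lambda>x::'a. ennreal (1 / norm x) * indicator {x. 1 \<le> norm x} x"
  let ?k = "ennreal ((1 - s) powr (1 - u))" and ?l = "ennreal (s powr (1 - u))"
  let ?E = "{x. e \<le> N x}"
  let ?ray = "\<lambda>A x. emeasure radial_measure {r. r *\<^sub>R x \<in> A}"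
  interpret radial: sigma_finite_measure radial_measure by (rule sigma_finite_radial_measure)
  have [measurable]: "(\<lambda>x. ?ray A x) \<in> borel_measurable borel" if [measurable]: "A \<in> sets borel" for A :: "'a set"
  proof -
    have "(\<lambda>p. snd p *\<^sub>R fst p) \<in> borel \<Otimes>\<^sub>M radial_measure \<rightarrow>\<^sub>M (borel :: 'a measure)"
      by measurable
    from measurable_sets[OF this that]
    have "{p::'a \<times> real. snd p *\<^sub>R fst p \<in> A} \<in> sets (borel \<Otimes>\<^sub>M radial_measure)"
      by (simp add: space_pair_measure vimage_def radial_measure_def)
    from radial.measurable_emeasure_Pair[OF this] show ?thesis by (simp add: vimage_def)
  qed
  have ray: "?ray D x \<le> ?k * ?ray C x + ?l * ?ray ?E x" for x
  proof (cases "?ray C x = \<infinity>")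
    case True
    then show ?thesis using s by (simp add: ennreal_mult_top)
  next
    case False
    \<comment> \<open>With finite mass on this ray, \<open>C\<close> contains no initial segment of
      it. Both cases below derive a contradiction from such a segment.\<close>
    have contra: "\<not> {0<..r} \<subseteq> {r. r *\<^sub>R x \<in> C}" if "0 < r" for r
      using emeasure_radial_measure_top[of "{r. r *\<^sub>R x \<in> C}" r] that False by auto
    have near: "t *\<^sub>R x \<in> C" if "r *\<^sub>R x \<in> D" "0 < t" "t \<le> r" "(r - t) * N x \<le> e" for r t
    proof -
      have "(1 - t / r) * N (r *\<^sub>R x) = (r - t) * N x"
        using that N(2)[of r x] by (simp add: field_simps)
      then have "(t / r) *\<^sub>R (r *\<^sub>R x) \<in> C"
        using that by (intro D) auto
      then show ?thesis using that by simp
    qed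
    show ?thesis
    proof (cases "N x = 0")
      case True
      \<comment> \<open>Motion along this ray costs nothing, so a single point of \<open>D\<close>
        on it would put the whole segment down to the origin into \<open>C\<close>.\<close>
      have "{r. r *\<^sub>R x \<in> D} \<inter> {0<..} = {}"
      proof (intro equals0I)
        fix r assume r: "r \<in> {r. r *\<^sub>R x \<in> D} \<inter> {0<..}"
        then have "{0<..r} \<subseteq> {r. r *\<^sub>R x \<in> C}"
          using near[of r] True e by auto
        with contra[of r] r show False by auto
      qed
      then show ?thesis by (subst emeasure_radial_measure_pos) auto
    next
      case False
      with N(1)[of x] have Nx: "0 < N x" by simp
      define h where "h = e / N x"
      have h: "0 < h" "h * N x = e" using e Nx by (auto simp: h_def)
      have "emeasure radial_measure ({r. r *\<^sub>R x \<in> D} \<inter> {0<..}) \<le>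
          ?k * ?ray C x + ?l * emeasure radial_measure {h..}"
      proof (rule emeasure_radial_measure_shift)
        fix r assume "r \<in> {r. r *\<^sub>R x \<in> D} \<inter> {0<..}"
        then have r: "r *\<^sub>R x \<in> D" "0 < r" by auto
        \<comment> \<open>Otherwise even the whole way to the origin costs at most \<open>e\<close>,
          and \<open>C\<close> would contain an initial segment.\<close>
        have "h < r"
        proof (rule ccontr)
          assume "\<not> h < r"
          have "{0<..r} \<subseteq> {r. r *\<^sub>R x \<in> C}"
          proof safe
            fix t assume t: "t \<in> {0<..r}"
            then have "(r - t) * N x \<le> h * N x"
              using \<open>\<not> h < r\<close> Nx by (intro mult_right_mono) auto
            with near[OF r(1), of t] t h show "t *\<^sub>R x \<in> C" by auto
          qed
          with contra r show False by blast
        qed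
        with near[OF r(1), of "r - h"] h show "h < r \<and> r - h \<in> {r. r *\<^sub>R x \<in> C}" by auto
      qed (use h s in auto)
      also have "\<dots> \<le> ?k * ?ray C x + ?l * ?ray ?E x"
      proof (intro add_left_mono mult_left_mono emeasure_mono)
        show "{h..} \<subseteq> {r. r *\<^sub>R x \<in> ?E}"
        proof
          fix r assume "r \<in> {h..}"
          then have "0 < r" "h * N x \<le> r * N x" using h Nx by auto
          then show "r \<in> {r. r *\<^sub>R x \<in> ?E}" using h N(2) by simp
        qed
        have "{r. r *\<^sub>R x \<in> ?E} \<in> sets borel" by measurable
        then show "{r. r *\<^sub>R x \<in> ?E} \<in> sets radial_measure" by simp
      qed simp_all
      finally show ?thesis by (subst emeasure_radial_measure_pos) auto
    qed
  qed
  have "emeasure M D = (\<integral>\<^sup>+x. ?g x * ?ray D x \<partial>M)"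
    by (rule emeasure_polar) measurable
  also have "\<dots> \<le> (\<integral>\<^sup>+x. ?k * (?g x * ?ray C x) + ?l * (?g x * ?ray ?E x) \<partial>M)"
  proof (rule nn_integral_mono)
    fix x
    have "?g x * ?ray D x \<le> ?g x * (?k * ?ray C x + ?l * ?ray ?E x)"
      by (intro mult_left_mono ray) auto
    then show "?g x * ?ray D x \<le> ?k * (?g x * ?ray C x) + ?l * (?g x * ?ray ?E x)"
      by (simp add: distrib_left mult_ac)
  qed
  also have "\<dots> = (\<integral>\<^sup>+x. ?k * (?g x * ?ray C x) \<partial>M) + (\<integral>\<^sup>+x. ?l * (?g x * ?ray ?E x) \<partial>M)"
    by (rule nn_integral_add) measurable
  also have "(\<integral>\<^sup>+x. ?k * (?g x * ?ray C x) \<partial>M) = ?k * (\<integral>\<^sup>+x. ?g x * ?ray C x \<partial>M)"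
    by (rule nn_integral_cmult) measurable
  also have "(\<integral>\<^sup>+x. ?l * (?g x * ?ray ?E x) \<partial>M) = ?l * (\<integral>\<^sup>+x. ?g x * ?ray ?E x \<partial>M)"
    by (rule nn_integral_cmult) measurable
  also have "(\<integral>\<^sup>+x. ?g x * ?ray C x \<partial>M) = emeasure M C"
    by (rule emeasure_polar[symmetric]) measurable
  also have "(\<integral>\<^sup>+x. ?g x * ?ray ?E x \<partial>M) = emeasure M ?E"
    by (rule emeasure_polar[symmetric]) measurable
  finally show ?thesis .
qed

end

section \<open>Semi-norms and Minkowski sums of their balls\<close>

lemma semi_norm_scaleR: "semi_norm N \<Longrightarrow> 0 \<le> l \<Longrightarrow> N (l *\<^sub>R x) = l * N x"
  by (simp add: semi_norm_def)

text \<open>Subadditivity and positive homogeneity make \<open>N\<close> convex, and a finite convex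
  function on a Euclidean space is continuous. Hence balls are open and \<open>N\<close> is
  Borel.\<close>

lemma continuous_on_semi_norm:
  fixes N :: "'a::euclidean_space \<Rightarrow> real"
  assumes N: "semi_norm N"
  shows "continuous_on UNIV N"
proof (rule convex_on_continuous)
  show "convex_on UNIV N"
  proof (rule convex_onI)
    fix t :: real and x y :: 'a
    assume t: "0 < t" "t < 1"
    have "N ((1 - t) *\<^sub>R x + t *\<^sub>R y) \<le> N ((1 - t) *\<^sub>R x) + N (t *\<^sub>R y)"
      using N by (simp add: semi_norm_def)
    then show "N ((1 - t) *\<^sub>R x + t *\<^sub>R y) \<le> (1 - t) * N x + t * N y"
      using t N by (simp add: semi_norm_scaleR)
  qed simp
qed simp

lemma scaleR_image_unit_ball:
  fixes N :: "'a::real_vector \<Rightarrow> real"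
  assumes N: "semi_norm N" and t: "0 < t"
  shows "(*\<^sub>R) t ` unit_ball N = {x. N x < t}"
proof (intro equalityI subsetI)
  fix x assume "x \<in> {x. N x < t}"
  then have "N ((1 / t) *\<^sub>R x) < 1"
    using t by (subst semi_norm_scaleR[OF N]) (auto simp: field_simps)
  then show "x \<in> (*\<^sub>R) t ` unit_ball N"
    using t by (intro image_eqI[where x = "(1 / t) *\<^sub>R x"]) (auto simp: unit_ball_def)
next
  fix x assume "x \<in> (*\<^sub>R) t ` unit_ball N"
  then show "x \<in> {x. N x < t}" using t N by (auto simp: unit_ball_def semi_norm_scaleR)
qed

text \<open>Splitting a point into its multiples by \<open>s / (s + t)\<close> and
  \<open>t / (s + t)\<close> gives the inclusion from right to left. Enlarging a ball thus yields a
  ball again, which is the source of equality for complements of balls.\<close>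

lemma semi_norm_ball_add:
  fixes N :: "'a::real_vector \<Rightarrow> real"
  assumes N: "semi_norm N" and "0 < s" "0 < t"
  shows "{x. N x < s} + {x. N x < t} = {x. N x < s + t}"
proof (intro equalityI subsetI)
  fix x assume "x \<in> {x. N x < s} + {x. N x < t}"
  then obtain a b where "x = a + b" "N a < s" "N b < t" by (auto simp: set_plus_def)
  moreover have "N (a + b) \<le> N a + N b" using N by (simp add: semi_norm_def)
  ultimately show "x \<in> {x. N x < s + t}" by auto
next
  fix x assume "x \<in> {x. N x < s + t}"
  then have x: "N x / (s + t) < 1" using assms by simp
  have "N ((s / (s + t)) *\<^sub>R x) = s * (N x / (s + t))" "N ((t / (s + t)) *\<^sub>R x) = t * (N x / (s + t))"
    using assms by (simp_all add: semi_norm_scaleR[OF N])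
  moreover have "s * (N x / (s + t)) < s * 1" "t * (N x / (s + t)) < t * 1"
    using assms x by (intro mult_strict_left_mono; simp)+
  ultimately have "N ((s / (s + t)) *\<^sub>R x) < s" "N ((t / (s + t)) *\<^sub>R x) < t" by simp_all
  moreover have "x = (s / (s + t)) *\<^sub>R x + (t / (s + t)) *\<^sub>R x"
    using assms by (simp add: scaleR_left_distrib[symmetric] add_divide_distrib[symmetric])
  ultimately show "x \<in> {x. N x < s} + {x. N x < t}"
    unfolding set_plus_def by blast
qed

text \<open>The sum is a union of translates of the open summand. Enlargements by an open ball are
  therefore Borel, which a Minkowski sum of Borel sets need not be.\<close>

lemma open_set_plus:
  fixes S T :: "'a::real_normed_vector set"
  assumes "open T"
  shows "open (S + T)"
proof -
  have "S + T = (\<Union>x\<in>S. \<Union>y\<in>T. {x + y})" by (auto simp: set_plus_def)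
  then show ?thesis using open_sums[of S T] assms by simp
qed

section \<open>The inner boundary measure: lower bound and equality case\<close>

context scaling_measure
begin

lemma emeasure_semi_norm_superlevel:
  assumes N: "semi_norm N" and t: "0 < t"
  shows "emeasure M {x. t \<le> N x} = ennreal (t powr u) * emeasure M {x. 1 \<le> N x}"
proof -
  have [measurable]: "N \<in> borel_measurable borel"
    by (rule borel_measurable_continuous_onI[OF continuous_on_semi_norm[OF N]])
  have "{x. t \<le> N x} = (*\<^sub>R) t ` {x. 1 \<le> N x}"
  proof (intro equalityI subsetI)
    fix x assume "x \<in> {x. t \<le> N x}"
    then have "1 \<le> N ((1 / t) *\<^sub>R x)"
      using t by (subst semi_norm_scaleR[OF N]) (auto simp: field_simps)
    then show "x \<in> (*\<^sub>R) t ` {x. 1 \<le> N x}"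
      using t by (intro image_eqI[where x = "(1 / t) *\<^sub>R x"]) auto
  qed (use t N in \<open>auto simp: semi_norm_scaleR\<close>)
  then show ?thesis using t by (simp add: emeasure_scaleR)
qed

text \<open>The set on the left consists of the points \<open>x\<close> with \<open>x - b\<close> in
  \<open>C\<close> for all \<open>b\<close> in the ball of radius \<open>e\<close>. A radial
  displacement \<open>(1 - r) *\<^sub>R x\<close> of length at most \<open>e'\<close> belongs to
  that open ball because \<open>e' < e\<close>; this is the reason for the two radii.\<close>

lemma emeasure_compl_dilation_le:
  assumes N: "semi_norm N" and [measurable]: "C \<in> sets borel"
    and e: "0 < e'" "e' < e" and s: "0 < s" "s < 1"
  shows "emeasure M (- (- C + {x. N x < e})) \<le>
    ennreal ((1 - s) powr (1 - u)) * emeasure M C +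
    ennreal (s powr (1 - u)) * (ennreal (e' powr u) * emeasure M {x. 1 \<le> N x})"
proof -
  have cont: "continuous_on UNIV N" by (rule continuous_on_semi_norm[OF N])
  have "open {x. N x < e}" using cont by (intro open_Collect_less) auto
  then have "open (- C + {x. N x < e})" by (rule open_set_plus)
  then have "- (- C + {x. N x < e}) \<in> sets borel" by auto
  then have "emeasure M (- (- C + {x. N x < e})) \<le>
    ennreal ((1 - s) powr (1 - u)) * emeasure M C +
    ennreal (s powr (1 - u)) * emeasure M {x. e' \<le> N x}"
  proof (rule emeasure_le_of_radial_erosion[rotated])
    show "N \<in> borel_measurable borel" by (rule borel_measurable_continuous_onI[OF cont])
    show "0 \<le> N x" for x using N by (simp add: semi_norm_def)
    show "N (r *\<^sub>R x) = r * N x" if "0 < r" for r x using that N by (simp add: semi_norm_scaleR)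
    fix x r
    assume x: "x \<in> - (- C + {x. N x < e})" and r: "0 < r" "r \<le> 1" and le: "(1 - r) * N x \<le> e'"
    have "x = r *\<^sub>R x + (1 - r) *\<^sub>R x" by (simp add: scaleR_left_distrib[symmetric])
    moreover have "N ((1 - r) *\<^sub>R x) < e" using r le e N by (simp add: semi_norm_scaleR)
    ultimately show "r *\<^sub>R x \<in> C" using x unfolding set_plus_def by blast
  qed (use e s in auto)
  then show ?thesis unfolding emeasure_semi_norm_superlevel[OF N e(1)] .
qed

lemma inner_boundary_measure_eq:
  assumes N: "semi_norm N"
  shows "inner_boundary_measure M N C =
    Liminf (at_right 0) (\<lambda>e. emeasure M ((- C + {x. N x < e}) - - C) / ennreal e)"
  unfolding inner_boundary_measure_def Let_def Compl_eq_Diff_UNIV[symmetric]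
proof (rule Liminf_eq)
  show "\<forall>\<^sub>F e in at_right 0.
      emeasure M (- C + (*\<^sub>R) e ` unit_ball N - - C) / ennreal e =
      emeasure M (- C + {x. N x < e} - - C) / ennreal e"
    using eventually_at_right_less[of "0 :: real"]
    by eventually_elim (simp only: scaleR_image_unit_ball[OF N])
qed

lemma inner_boundary_measure_ge_linear:
  assumes N: "semi_norm N" and [measurable]: "C \<in> sets borel"
    and a: "emeasure M C = ennreal a" "0 \<le> a"
    and b: "emeasure M {x. 1 \<le> N x} = ennreal b" "0 \<le> b"
    and c: "0 < c"
  shows "ennreal ((1 - u) * c * a - c powr (1 - u) * b) \<le> inner_boundary_measure M N C"
proof -
  \<comment> \<open>the tangent inequality with \<open>s = c * e\<close>, applied at radius \<open>e * (1 - e) < e\<close>\<close>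
  define f where "f e = - a * (((1 - c * e) powr (1 - u) - 1) / e) -
      c powr (1 - u) * (1 - e) powr u * b" for e
  have "((\<lambda>e. (1 - c * e) powr (1 - u)) has_real_derivative - ((1 - u) * c)) (at 0)"
    by (auto intro!: derivative_eq_intros)
  then have "((\<lambda>e. (1 - c * e) powr (1 - u)) has_real_derivative - ((1 - u) * c)) (at_right 0)"
    by (rule has_field_derivative_at_within)
  then have "((\<lambda>e. ((1 - c * e) powr (1 - u) - 1) / e) \<longlongrightarrow> - ((1 - u) * c)) (at_right 0)"
    by (simp add: has_field_derivative_iff)
  moreover have "((\<lambda>e. (1 - e) powr u) \<longlongrightarrow> 1) (at_right (0::real))"
    by (auto intro!: tendsto_eq_intros)
  ultimately have "(f \<longlongrightarrow> - a * (- ((1 - u) * c)) - c powr (1 - u) * 1 * b) (at_right 0)"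
    unfolding f_def by (intro tendsto_diff tendsto_mult tendsto_const)
  then have "((\<lambda>e. ennreal (f e)) \<longlongrightarrow> ennreal ((1 - u) * c * a - c powr (1 - u) * b)) (at_right 0)"
    by (intro tendsto_ennrealI) (simp add: mult_ac)
  then have "ennreal ((1 - u) * c * a - c powr (1 - u) * b) = Liminf (at_right 0) (\<lambda>e. ennreal (f e))"
    by (intro lim_imp_Liminf[symmetric]) auto
  also have "\<dots> \<le> inner_boundary_measure M N C"
    unfolding inner_boundary_measure_eq[OF N]
  proof (rule Liminf_mono)
    \<comment> \<open>\<open>e < 1\<close> keeps the radius \<open>e * (1 - e)\<close> positive, and
      \<open>e < 1 / c\<close> keeps \<open>s = c * e\<close> below 1.\<close>
    have "eventually (\<lambda>e. e \<in> {0<..<min 1 (1 / c)}) (at_right 0)"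
      using c by (intro eventually_at_right_real) auto
    then show "\<forall>\<^sub>F e in at_right 0. ennreal (f e) \<le> emeasure M ((- C + {x. N x < e}) - - C) / ennreal e"
    proof eventually_elim
      fix e assume "e \<in> {0<..<min 1 (1 / c)}"
      then have e: "0 < e" "e < 1" "c * e < 1" using c by (auto simp: field_simps)
      let ?D = "- (- C + {x. N x < e})"
      have "continuous_on UNIV N" by (rule continuous_on_semi_norm[OF N])
      then have "open {x. N x < e}" by (intro open_Collect_less) auto
      then have "open (- C + {x. N x < e})" by (rule open_set_plus)
      then have D: "?D \<in> sets M" by (auto simp: sets_eq_borel)
      \<comment> \<open>The ball contains the origin, so the complement of \<open>C\<close> is part
        of its own enlargement.\<close>
      have "N 0 = 0" using semi_norm_scaleR[OF N, of 0 0] by simp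
      then have "?D \<subseteq> C" using e by (force simp: set_plus_def)
      have "emeasure M ?D \<le> ennreal ((1 - c * e) powr (1 - u)) * ennreal a +
          ennreal ((c * e) powr (1 - u)) * (ennreal ((e * (1 - e)) powr u) * ennreal b)"
        unfolding a(1)[symmetric] b(1)[symmetric]
        using e c by (intro emeasure_compl_dilation_le N) auto
      also have "\<dots> = ennreal ((1 - c * e) powr (1 - u) * a +
          (c * e) powr (1 - u) * ((e * (1 - e)) powr u * b))"
        using a b by (simp add: ennreal_mult[symmetric] ennreal_plus[symmetric] del: ennreal_plus)
      \<comment> \<open>\<open>f\<close> is defined so that this identity holds. The powers
        \<open>e powr (1 - u)\<close> and \<open>e powr u\<close> multiply to \<open>e\<close>,
        which makes the second summand of first order in \<open>e\<close>.\<close>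
      also have R: "(1 - c * e) powr (1 - u) * a +
          (c * e) powr (1 - u) * ((e * (1 - e)) powr u * b) = a - e * f e"
      proof -
        have "(c * e) powr (1 - u) * ((e * (1 - e)) powr u * b) =
            e * (c powr (1 - u) * (1 - e) powr u * b)"
          using e c by (simp add: powr_mult powr_diff)
        then show ?thesis using e by (simp add: f_def field_simps)
      qed
      finally have le: "emeasure M ?D \<le> ennreal (a - e * f e)" .
      \<comment> \<open>Where \<open>f e\<close> is negative, \<open>ennreal (f e)\<close> is 0 and
        the bound is trivial.\<close>
      show "ennreal (f e) \<le> emeasure M ((- C + {x. N x < e}) - - C) / ennreal e"
      proof (cases "0 \<le> f e")
        case True
        have "emeasure M ?D \<le> ennreal a"
          using emeasure_mono[OF \<open>?D \<subseteq> C\<close>, of M] a by (simp add: sets_eq_borel)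
        then obtain d where d: "emeasure M ?D = ennreal d" "0 \<le> d"
          by (cases "emeasure M ?D") (auto simp: top_unique)
        have "0 \<le> a - e * f e" unfolding R[symmetric] using a b by simp
        then have "e * f e \<le> a - d"
          using le d by (simp add: ennreal_le_iff)
        have "(- C + {x. N x < e}) - - C = C - ?D" by auto
        moreover have "emeasure M (C - ?D) = ennreal (a - d)"
          using emeasure_Diff[OF _ _ D \<open>?D \<subseteq> C\<close>] a d by (simp add: sets_eq_borel ennreal_minus)
        ultimately show ?thesis
          using e \<open>e * f e \<le> a - d\<close>
          by (simp add: divide_ennreal_pos ennreal_leI field_simps)
      qed (simp add: ennreal_neg)
    qed
  qed
  finally show ?thesis .
qed

text \<open>The linear lower bound is maximized over \<open>c\<close>. If \<open>C\<close> is null,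
  the left-hand side is 0, even when it contains the factor \<open>\<infinity>\<close>; if only the
  complement of the ball is null, it is infinite and arbitrarily large \<open>c\<close> give the
  claim.\<close>

lemma inner_boundary_measure_ge:
  assumes N: "semi_norm N" and C: "C \<in> sets borel"
    and fin: "emeasure M C < \<infinity>" "emeasure M {x. 1 \<le> N x} < \<infinity>"
  shows "ennreal (-u) * (enn_powr (emeasure M {x. 1 \<le> N x}) (1 / u) *
      enn_powr (emeasure M C) (1 - 1 / u)) \<le> inner_boundary_measure M N C"
proof -
  obtain a where a: "emeasure M C = ennreal a" "0 \<le> a"
    using fin(1) by (cases "emeasure M C") auto
  obtain b where b: "emeasure M {x. 1 \<le> N x} = ennreal b" "0 \<le> b"
    using fin(2) by (cases "emeasure M {x. 1 \<le> N x}") auto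
  have q: "1 - 1 / u > 0" using exponent_neg by (simp add: field_simps)
  note lower = inner_boundary_measure_ge_linear[OF N C a b]
  consider "a = 0" | "0 < a" "b = 0" | "0 < a" "0 < b" using a b by linarith
  then show ?thesis
  proof cases
    case 1
    then show ?thesis using q exponent_neg by (simp add: a enn_powr_def)
  next
    case 2
    have "inner_boundary_measure M N C = \<infinity>"
    proof (rule ccontr)
      assume "inner_boundary_measure M N C \<noteq> \<infinity>"
      then obtain r where r: "inner_boundary_measure M N C = ennreal r" "0 \<le> r"
        by (cases "inner_boundary_measure M N C") auto
      have pos: "0 < (1 - u) * a" using 2 exponent_neg by simp
      \<comment> \<open>Chosen so that the lower bound, here just \<open>(1 - u) * c * a\<close>,
        equals \<open>r + 1\<close>.\<close>
      define c where "c = (r + 1) / ((1 - u) * a)"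
      have "0 < c" using pos r by (simp add: c_def)
      have "(1 - u) * c * a = r + 1" using 2 exponent_neg by (simp add: c_def)
      with lower[OF \<open>0 < c\<close>] r 2 have "ennreal (r + 1) \<le> ennreal r" by simp
      with r show False by (simp add: ennreal_le_iff)
    qed
    then show ?thesis by simp
  next
    case 3
    \<comment> \<open>The critical point of \<open>(1 - u) * c * a - c powr (1 - u) * b\<close>: a
      vanishing derivative in \<open>c\<close> means \<open>c powr (- u) = a / b\<close>, and the
      value there is \<open>- u * c * a\<close>.\<close>
    define c where "c = (b / a) powr (1 / u)"
    have c: "0 < c" using 3 by (simp add: c_def)
    have "c powr (- u) = a / b"
      using 3 exponent_neg by (simp add: c_def powr_powr powr_minus_divide)
    then have "c powr (1 - u) * b = c * a"
      using c 3 powr_add[of c 1 "- u"] by simp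
    moreover have "c * a = b powr (1 / u) * a powr (1 - 1 / u)"
      using 3 by (simp add: c_def powr_divide powr_diff)
    ultimately have "(1 - u) * c * a - c powr (1 - u) * b =
        - u * (b powr (1 / u) * a powr (1 - 1 / u))"
      by (simp add: algebra_simps)
    with lower[OF c] show ?thesis
      using exponent_neg 3 by (simp add: a b enn_powr_ennreal ennreal_mult[symmetric])
  qed
qed

text \<open>Enlarging the ball of radius \<open>t\<close> by \<open>e\<close> gives the ball of
  radius \<open>t + e\<close>, so the quotient is a difference quotient of
  \<open>- b * t powr u\<close> and converges to \<open>- b * (u * t powr (u - 1))\<close>. In the
  bound, \<open>b\<close> has total exponent \<open>1 / u + (1 - 1 / u) = 1\<close> and
  \<open>t\<close> has exponent \<open>u * (1 - 1 / u) = u - 1\<close>, so the two agree.\<close>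

lemma inner_boundary_measure_superlevel:
  assumes N: "semi_norm N" and fin: "emeasure M {x. 1 \<le> N x} < \<infinity>" and t: "0 < t"
  shows "inner_boundary_measure M N {x. t \<le> N x} =
      ennreal (-u) * (enn_powr (emeasure M {x. 1 \<le> N x}) (1 / u) *
        enn_powr (emeasure M {x. t \<le> N x}) (1 - 1 / u))"
proof -
  have cont: "continuous_on UNIV N" by (rule continuous_on_semi_norm[OF N])
  have [measurable]: "N \<in> borel_measurable borel" by (rule borel_measurable_continuous_onI[OF cont])
  obtain b where b: "emeasure M {x. 1 \<le> N x} = ennreal b" "0 \<le> b"
    using fin by (cases "emeasure M {x. 1 \<le> N x}") auto
  have level: "emeasure M {x. s \<le> N x} = ennreal (s powr u * b)" if "0 < s" for s
    using emeasure_semi_norm_superlevel[OF N that] b by (simp add: ennreal_mult)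
  have compl: "- {x. t \<le> N x} = {x. N x < t}" by auto
  have "((\<lambda>e. (t + e) powr u) has_real_derivative u * t powr (u - 1)) (at 0)"
    using t by (auto intro!: derivative_eq_intros)
  then have "((\<lambda>e. (t + e) powr u) has_real_derivative u * t powr (u - 1)) (at_right 0)"
    by (rule has_field_derivative_at_within)
  then have "((\<lambda>e. ((t + e) powr u - t powr u) / e) \<longlongrightarrow> u * t powr (u - 1)) (at_right 0)"
    by (simp add: has_field_derivative_iff)
  then have "((\<lambda>e. ennreal (- b * (((t + e) powr u - t powr u) / e))) \<longlongrightarrow>
      ennreal (- b * (u * t powr (u - 1)))) (at_right 0)"
    by (intro tendsto_ennrealI tendsto_mult tendsto_const)
  then have "Liminf (at_right 0) (\<lambda>e. ennreal (- b * (((t + e) powr u - t powr u) / e))) =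
      ennreal (- b * (u * t powr (u - 1)))"
    by (intro lim_imp_Liminf) auto
  moreover have "inner_boundary_measure M N {x. t \<le> N x} =
      Liminf (at_right 0) (\<lambda>e. ennreal (- b * (((t + e) powr u - t powr u) / e)))"
    unfolding inner_boundary_measure_eq[OF N] compl
  proof (rule Liminf_eq)
    show "\<forall>\<^sub>F e in at_right 0.
        emeasure M ({x. N x < t} + {x. N x < e} - {x. N x < t}) / ennreal e =
        ennreal (- b * (((t + e) powr u - t powr u) / e))"
      using eventually_at_right_less[of "0 :: real"]
    proof eventually_elim
      case (elim e)
      have "{x. N x < t} + {x. N x < e} - {x. N x < t} = {x. t \<le> N x} - {x. t + e \<le> N x}"
        using elim t by (auto simp: semi_norm_ball_add[OF N])
      moreover have "emeasure M ({x. t \<le> N x} - {x. t + e \<le> N x}) =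
          ennreal (t powr u * b) - ennreal ((t + e) powr u * b)"
      proof (subst emeasure_Diff)
        show "{x. t + e \<le> N x} \<in> sets M" unfolding sets_eq_borel by measurable
      qed (use elim t level in auto)
      moreover have "\<dots> = ennreal (t powr u * b - (t + e) powr u * b)"
        using b by (simp add: ennreal_minus)
      moreover have "(t powr u * b - (t + e) powr u * b) / e =
          - b * (((t + e) powr u - t powr u) / e)"
        using elim by (simp add: field_simps)
      ultimately show ?case
        using elim by (simp only: divide_ennreal_pos)
    qed
  qed
  moreover have "ennreal (- b * (u * t powr (u - 1))) =
      ennreal (-u) * (enn_powr (ennreal b) (1 / u) * enn_powr (ennreal (t powr u * b)) (1 - 1 / u))"
  proof (cases "b = 0")
    \<comment> \<open>The first of the two powers is then \<open>\<infinity>\<close> and the second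
      0; their product is 0 by convention.\<close>
    case True
    have "1 - 1 / u > 0" using exponent_neg by (simp add: field_simps)
    with True show ?thesis by (simp add: enn_powr_def)
  next
    case False
    with b have b0: "0 < b" by simp
    have "b powr (1 / u) * (t powr u * b) powr (1 - 1 / u) =
        (b powr (1 / u) * b powr (1 - 1 / u)) * t powr (u * (1 - 1 / u))"
      using t b0 by (simp add: powr_mult powr_powr)
    also have "b powr (1 / u) * b powr (1 - 1 / u) = b"
      using b0 by (simp add: powr_add[symmetric])
    also have "u * (1 - 1 / u) = u - 1" using exponent_neg by (simp add: field_simps)
    finally have "b powr (1 / u) * (t powr u * b) powr (1 - 1 / u) = b * t powr (u - 1)" .
    then show ?thesis
      using b0 t exponent_neg
      by (simp add: enn_powr_ennreal ennreal_mult[symmetric] mult.left_commute)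
  qed
  ultimately show ?thesis using t by (simp add: b level)
qed

text \<open>The lower bound depends on a competitor only through its mass, and the superlevel set
  attains it.\<close>

lemma isoperimetric_minimizer_superlevel:
  assumes N: "semi_norm N" and fin: "emeasure M {x. 1 \<le> N x} < \<infinity>" and t: "0 < t"
  shows "isoperimetric_minimizer M N {x. t \<le> N x}"
proof -
  have [measurable]: "N \<in> borel_measurable borel"
    by (rule borel_measurable_continuous_onI[OF continuous_on_semi_norm[OF N]])
  have "{x. t \<le> N x} \<in> sets borel" by measurable
  moreover have fin_t: "emeasure M {x. t \<le> N x} < \<infinity>"
    using fin unfolding emeasure_semi_norm_superlevel[OF N t] by (simp add: ennreal_mult_less_top)
  moreover have "inner_boundary_measure M N {x. t \<le> N x} \<le> inner_boundary_measure M N D"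
    if "D \<in> sets borel" "emeasure M D = emeasure M {x. t \<le> N x}" for D
    using inner_boundary_measure_ge[OF N that(1) _ fin] that(2) fin_t
    by (simp add: inner_boundary_measure_superlevel[OF N fin t])
  ultimately show ?thesis by (auto simp: isoperimetric_minimizer_def)
qed

end

section \<open>Homogeneous measures and densities\<close>

lemma scaling_measureI:
  fixes M :: "('a::euclidean_space) measure"
  assumes "q < 0" "sets M = sets borel" "sigma_finite_measure M" "homogeneous_measure q M"
  shows "scaling_measure M (1 / q)"
proof -
  interpret sigma_finite_measure M by fact
  show ?thesis
    using assms by unfold_locales (auto simp: homogeneous_measure_def enn_powr_neg_scale_iff)
qed

lemma nn_integral_lborel_scaleR:
  fixes f :: "'a::euclidean_space \<Rightarrow> ennreal"
  assumes [measurable]: "f \<in> borel_measurable borel" and l: "0 < l"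
  shows "(\<integral>\<^sup>+x. f x \<partial>lborel) = ennreal (l ^ DIM('a)) * (\<integral>\<^sup>+x. f (l *\<^sub>R x) \<partial>lborel)"
proof -
  have "(\<integral>\<^sup>+x. f x \<partial>lborel) =
      (\<integral>\<^sup>+x. f x \<partial>density (distr lborel borel (\<lambda>x. 0 + l *\<^sub>R x)) (\<lambda>_. \<bar>l\<bar> ^ DIM('a)))"
    using l by (subst lborel_affine[of l 0]) auto
  also have "\<dots> = ennreal (l ^ DIM('a)) * (\<integral>\<^sup>+x. f (l *\<^sub>R x) \<partial>lborel)"
    using l by (simp add: nn_integral_density nn_integral_distr nn_integral_cmult)
  finally show ?thesis .
qed

text \<open>Singletons are closed in a T1 space, so the value at \<open>a\<close> cannot spoil
  measurability. The density of the theorem is assumed Borel only away from the origin.\<close>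

lemma borel_measurable_of_off_singleton:
  fixes w :: "'a::t1_space \<Rightarrow> real"
  assumes "w \<in> borel_measurable (restrict_space borel (UNIV - {a}))"
  shows "w \<in> borel_measurable borel"
proof -
  have "(\<lambda>x. if x \<in> {a} then w a else w x) \<in> borel_measurable borel"
  proof (rule measurable_If_restrict_space_iff[THEN iffD2])
    show "{x \<in> space borel. x \<in> {a}} \<in> sets borel" by simp
    have "(\<lambda>x. w a) \<in> borel_measurable (restrict_space borel {x. x \<in> {a}})" by simp
    then show "(\<lambda>x. w a) \<in> borel_measurable (restrict_space borel {x. x \<in> {a}}) \<and>
        w \<in> borel_measurable (restrict_space borel {x. x \<notin> {a}})"
      using assms by (simp add: Compl_eq_Diff_UNIV[symmetric] Collect_neg_eq)
  qed
  moreover have "(\<lambda>x. if x \<in> {a} then w a else w x) = w" by auto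
  ultimately show ?thesis by simp
qed

lemma homogeneous_density_scaleR:
  assumes "p < 0" "homogeneous_density p w" "x \<noteq> 0" "0 < l"
  shows "ennreal (w (l *\<^sub>R x)) = ennreal (l powr (1 / p)) * ennreal (w x)"
  using assms by (auto simp: homogeneous_density_def enn_powr_neg_scale_iff)

text \<open>The substitution by \<open>l\<close> contributes the Jacobian \<open>l ^ DIM('a)\<close>
  and the density the factor \<open>l powr (1 / p)\<close>; by \<open>pq\<close> the exponents add
  up to \<open>1 / q\<close>.\<close>

lemma homogeneous_measure_density:
  fixes w :: "'a::euclidean_space \<Rightarrow> real"
  assumes q: "q < 0" and p: "p < 0" and pq: "1 / q = 1 / p + real DIM('a)"
    and [measurable]: "w \<in> borel_measurable borel" and w: "homogeneous_density p w"
  shows "homogeneous_measure q (density lborel (\<lambda>x. ennreal (w x)))"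
  unfolding homogeneous_measure_def
proof (intro ballI allI impI)
  fix A :: "'a set" and l :: real
  assume A [measurable]: "A \<in> sets borel" and l: "0 < l"
  let ?M = "density lborel (\<lambda>x. ennreal (w x))"
  have img: "(*\<^sub>R) l ` A = (\<lambda>x. (1 / l) *\<^sub>R x) -` A"
  proof (intro equalityI subsetI)
    fix x assume "x \<in> (\<lambda>x. (1 / l) *\<^sub>R x) -` A"
    then show "x \<in> (*\<^sub>R) l ` A" using l by (intro image_eqI[where x = "(1 / l) *\<^sub>R x"]) auto
  qed (use l in auto)
  have lA [measurable]: "(*\<^sub>R) l ` A \<in> sets borel"
    unfolding img using measurable_sets[of "\<lambda>x. (1 / l) *\<^sub>R x" borel borel A] by simp
  have ind: "indicator ((*\<^sub>R) l ` A) (l *\<^sub>R x) = (indicator A x :: ennreal)" for x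
    using l by (auto simp: indicator_def)
  have "emeasure ?M ((*\<^sub>R) l ` A) = (\<integral>\<^sup>+x. ennreal (w x) * indicator ((*\<^sub>R) l ` A) x \<partial>lborel)"
    by (subst emeasure_density) auto
  also have "\<dots> = ennreal (l ^ DIM('a)) * (\<integral>\<^sup>+x. ennreal (w (l *\<^sub>R x)) * indicator A x \<partial>lborel)"
    using l by (subst nn_integral_lborel_scaleR[where l = l]) (auto simp: ind)
  also have "(\<integral>\<^sup>+x. ennreal (w (l *\<^sub>R x)) * indicator A x \<partial>lborel) =
      (\<integral>\<^sup>+x. ennreal (l powr (1 / p)) * (ennreal (w x) * indicator A x) \<partial>lborel)"
  proof (rule nn_integral_cong_AE)
    \<comment> \<open>Homogeneity of \<open>w\<close> says nothing at the origin, which is a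
      Lebesgue null set.\<close>
    have "AE x in lborel. x \<noteq> (0 :: 'a)" by (rule AE_lborel_singleton)
    then show "AE x in lborel. ennreal (w (l *\<^sub>R x)) * indicator A x =
        ennreal (l powr (1 / p)) * (ennreal (w x) * indicator A x)"
      by eventually_elim (simp add: homogeneous_density_scaleR[OF p w _ l] mult.assoc)
  qed
  also have "\<dots> = ennreal (l powr (1 / p)) * emeasure ?M A"
    by (simp add: nn_integral_cmult emeasure_density)
  also have "ennreal (l ^ DIM('a)) * (ennreal (l powr (1 / p)) * emeasure ?M A) =
      ennreal (l powr (1 / q)) * emeasure ?M A"
    using l by (simp add: pq powr_add powr_realpow mult.assoc[symmetric] ennreal_mult[symmetric] mult.commute)
  finally show "enn_powr (emeasure ?M ((*\<^sub>R) l ` A)) q = ennreal l * enn_powr (emeasure ?M A) q"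
    using enn_powr_neg_scale_iff[OF q l] by blast
qed

theorem corollary4p6:
  fixes q :: real
  assumes "q < 0"
  shows "(\<forall>(\<mu> :: (real ^ 'n) measure) N.
      sets \<mu> = sets borel \<and> sigma_finite_measure \<mu> \<and> homogeneous_measure q \<mu> \<and>
      semi_norm N \<and> emeasure \<mu> (UNIV - unit_ball N) < \<infinity> \<longrightarrow>
        (\<forall>C \<in> sets borel. emeasure \<mu> C < \<infinity> \<longrightarrow>
          inner_boundary_measure \<mu> N C \<ge>
            ennreal (- (1 / q)) * (enn_powr (emeasure \<mu> (UNIV - unit_ball N)) q
              * enn_powr (emeasure \<mu> C) (1 - q))) \<and>
        (\<forall>t>0. let C = UNIV - (*\<^sub>R) t ` unit_ball N in
          inner_boundary_measure \<mu> N C =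
            ennreal (- (1 / q)) * (enn_powr (emeasure \<mu> (UNIV - unit_ball N)) q
              * enn_powr (emeasure \<mu> C) (1 - q)) \<and>
          isoperimetric_minimizer \<mu> N C))
    \<and> (\<forall>(w :: real ^ 'n \<Rightarrow> real) p.
      - (1 / real CARD('n)) < p \<and> p < 0 \<and> 1 / q = 1 / p + real CARD('n) \<and>
      w \<in> borel_measurable (restrict_space borel (UNIV - {0})) \<and>
      (\<forall>x. x \<noteq> 0 \<longrightarrow> 0 \<le> w x) \<and> homogeneous_density p w \<longrightarrow>
        sets (density lborel (\<lambda>x. ennreal (w x))) = sets borel \<and>
        sigma_finite_measure (density lborel (\<lambda>x. ennreal (w x))) \<and>
        homogeneous_measure q (density lborel (\<lambda>x. ennreal (w x))))"
proof (intro conjI allI impI)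
  fix \<mu> :: "(real ^ 'n) measure" and N
  assume A: "sets \<mu> = sets borel \<and> sigma_finite_measure \<mu> \<and> homogeneous_measure q \<mu> \<and>
      semi_norm N \<and> emeasure \<mu> (UNIV - unit_ball N) < \<infinity>"
  \<comment> \<open>With \<open>u\<close> equal to \<open>1 / q\<close>, the exponents
    \<open>1 / u\<close> and \<open>1 - 1 / u\<close> become \<open>q\<close> and
    \<open>1 - q\<close>.\<close>
  then interpret scaling_measure \<mu> "1 / q" using \<open>q < 0\<close> by (intro scaling_measureI) auto
  have N: "semi_norm N" using A by simp
  have K: "UNIV - unit_ball N = {x. 1 \<le> N x}" by (auto simp: unit_ball_def)
  have fin: "emeasure \<mu> {x. 1 \<le> N x} < \<infinity>" using A by (simp add: K)
  show "\<forall>C \<in> sets borel. emeasure \<mu> C < \<infinity> \<longrightarrow>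
      ennreal (- (1 / q)) * (enn_powr (emeasure \<mu> (UNIV - unit_ball N)) q
        * enn_powr (emeasure \<mu> C) (1 - q)) \<le> inner_boundary_measure \<mu> N C"
    using inner_boundary_measure_ge[OF N _ _ fin] by (simp add: K)
  fix t :: real assume t: "0 < t"
  have tK: "UNIV - (*\<^sub>R) t ` unit_ball N = {x. t \<le> N x}"
    by (auto simp: scaleR_image_unit_ball[OF N t])
  show "let C = UNIV - (*\<^sub>R) t ` unit_ball N in
      inner_boundary_measure \<mu> N C =
        ennreal (- (1 / q)) * (enn_powr (emeasure \<mu> (UNIV - unit_ball N)) q
          * enn_powr (emeasure \<mu> C) (1 - q)) \<and>
      isoperimetric_minimizer \<mu> N C"
    unfolding Let_def tK K
    using inner_boundary_measure_superlevel[OF N fin t] isoperimetric_minimizer_superlevel[OF N fin t]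
    by simp
next
  fix w :: "real ^ 'n \<Rightarrow> real" and p
  assume A: "- (1 / real CARD('n)) < p \<and> p < 0 \<and> 1 / q = 1 / p + real CARD('n) \<and>
      w \<in> borel_measurable (restrict_space borel (UNIV - {0})) \<and>
      (\<forall>x. x \<noteq> 0 \<longrightarrow> 0 \<le> w x) \<and> homogeneous_density p w"
  have w [measurable]: "w \<in> borel_measurable borel"
    using A by (intro borel_measurable_of_off_singleton) auto
  show "sets (density lborel (\<lambda>x. ennreal (w x))) = sets borel" by simp
  show "sigma_finite_measure (density lborel (\<lambda>x. ennreal (w x)))"
    \<comment> \<open>The density comes from a real-valued function and is finite
      everywhere.\<close>
    by (subst sigma_finite_measure.sigma_finite_iff_density_finite[OF sigma_finite_lborel]) auto
  show "homogeneous_measure q (density lborel (\<lambda>x. ennreal (w x)))"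
    using A \<open>q < 0\<close> w by (intro homogeneous_measure_density[where p = p]) auto
qed

end
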